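(* Let $M$ be a matroid of finite rank on ground set $E$, and let $\mathbf Z,\mathbf B$ be two filtrations on $M$ by closed sets such that $\mathbf B_p\subseteq\mathbf Z_p$ for all $p\in\mathbb Z$. Let $N$ and $T:N\to N$ be the associated matroid and map. Then $T$ has a Jordan basis if and only if the family $\{\mathbf Z_p\}_{p}\cup\{\mathbf B_p\}_{p}$ obeys the modular law in $M$.
   Context: A filtration on $M$ is given by a function $\mathbf F:E\to\{1,\dots,n\}$, with $\mathbf F_p=\{e\in E:\mathbf F(e)\le p\}$ for $p\in\mathbb Z$ (so $\mathbf F_p=\emptyset$ for $p\le 0$ and $\mathbf F_p=E$ for $p\ge n$); it is a filtration by closed sets if $\mathbf F_1,\dots,\mathbf F_n$ are flats of $M$. For each $p$ let $H_p$ be the matroid on ground set $\mathbf Z_p$ in which a set $I$ is independent iff $I\cup J$ is independent in $M$ and $I\cap J=\emptyset$ for a (equivalently every) basis $J$ of $\mathbf B_p$; in particular elements of $\mathbf B_p$ are loops of $H_p$. Let $N$ be the direct sum (matroid union on disjoint ground sets) of all $H_p$, $p\in\mathbb Z$, and write $e^{(p)}$ for the copy of $e\in\mathbf Z_p$ in $H_p$. Let $T$ be the map $T(e^{(p)})=e^{(p+1)}$. The orbit of an element $x$ of $N$ is the set of all non-loops of the form $T^m x$, $m\ge0$. A Jordan basis of $T$ is a basis of $N$ that is a disjoint union of orbits of elements. A family $\mathcal S$ of subsets of $E$ obeys the modular law if $\rho(S\cup S')+\rho(S\cap S')=\rho(S)+\rho(S')$ for all $S,S'\in\mathcal S$, where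 $\rho$ is the rank function of $M$. *)

theory Defs
  imports Main "HOL-Library.Disjoint_Sets"
begin

record 'a matroid =
  ground :: "'a set"
  indep :: "'a set \<Rightarrow> bool"

text \<open>
  The ground set may be infinite; only the independent sets are uniformly bounded in size.
\<close>

definition finite_rank_matroid :: "'a matroid \<Rightarrow> bool" where
  "finite_rank_matroid M \<longleftrightarrow>
     (\<forall>I. indep M I \<longrightarrow> I \<subseteq> ground M) \<and>
     indep M {} \<and>
     (\<forall>I J. indep M J \<longrightarrow> I \<subseteq> J \<longrightarrow> indep M I) \<and>
     (\<forall>I J. indep M I \<longrightarrow> indep M J \<longrightarrow> card I < card J \<longrightarrow>
        (\<exists>x \<in> J - I. indep M (insert x I))) \<and>
     (\<exists>k. \<forall>I. indep M I \<longrightarrow> finite I \<and> card I \<le> k)"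

definition rank :: "'a matroid \<Rightarrow> 'a set \<Rightarrow> nat" where
  "rank M S = Max {card I | I. I \<subseteq> S \<and> indep M I}"

definition basis_in :: "'a matroid \<Rightarrow> 'a set \<Rightarrow> 'a set \<Rightarrow> bool" where
  "basis_in M S J \<longleftrightarrow>
     J \<subseteq> S \<and> indep M J \<and> (\<forall>K. J \<subseteq> K \<longrightarrow> K \<subseteq> S \<longrightarrow> indep M K \<longrightarrow> K = J)"

definition basis :: "'a matroid \<Rightarrow> 'a set \<Rightarrow> bool" where
  "basis M J \<longleftrightarrow> basis_in M (ground M) J"

definition loop :: "'a matroid \<Rightarrow> 'a \<Rightarrow> bool" where
  "loop M x \<longleftrightarrow> x \<in> ground M \<and> \<not> indep M {x}"

definition closure_in :: "'a matroid \<Rightarrow> 'a set \<Rightarrow> 'a set" where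
  "closure_in M S = {e \<in> ground M. rank M (insert e S) = rank M S}"

definition flat :: "'a matroid \<Rightarrow> 'a set \<Rightarrow> bool" where
  "flat M S \<longleftrightarrow> S \<subseteq> ground M \<and> closure_in M S = S"

definition modular_law :: "'a matroid \<Rightarrow> 'a set set \<Rightarrow> bool" where
  "modular_law M \<S> \<longleftrightarrow>
     (\<forall>S \<in> \<S>. \<forall>S' \<in> \<S>. rank M (S \<union> S') + rank M (S \<inter> S') = rank M S + rank M S')"

definition level :: "'a matroid \<Rightarrow> ('a \<Rightarrow> int) \<Rightarrow> int \<Rightarrow> 'a set" where
  "level M F p = {e \<in> ground M. F e \<le> p}"

text \<open>
  The bound \<open>n\<close> belongs to the filtration: two filtrations on \<open>M\<close> need not share it.  As \<open>level M F p\<close>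
  does not depend on \<open>n\<close> and is the flat \<open>ground M\<close> for \<open>p \<ge> n\<close>, any larger bound serves as well.
  The empty sets \<open>level M F p\<close> with \<open>p \<le> 0\<close> are not required to be flats, so \<open>M\<close> may have loops.
\<close>

definition closed_filtration :: "'a matroid \<Rightarrow> ('a \<Rightarrow> int) \<Rightarrow> bool" where
  "closed_filtration M F \<longleftrightarrow>
     (\<exists>n. (\<forall>e \<in> ground M. F e \<in> {1..n}) \<and> (\<forall>p \<in> {1..n}. flat M (level M F p)))"

definition direct_sum :: "('i \<Rightarrow> 'a matroid) \<Rightarrow> ('a \<times> 'i) matroid" where
  "direct_sum H =
     \<lparr> ground = {(e, i). e \<in> ground (H i)},
       indep = (\<lambda>A. A \<subseteq> {(e, i). e \<in> ground (H i)} \<and> (\<forall>i. indep (H i) {e. (e, i) \<in> A})) \<rparr>"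

definition graded_piece ::
    "'a matroid \<Rightarrow> ('a \<Rightarrow> int) \<Rightarrow> ('a \<Rightarrow> int) \<Rightarrow> int \<Rightarrow> 'a matroid" where
  "graded_piece M Z B p =
     \<lparr> ground = level M Z p,
       indep = (\<lambda>I. I \<subseteq> level M Z p \<and>
                    (\<exists>J. basis_in M (level M B p) J \<and> indep M (I \<union> J) \<and> I \<inter> J = {})) \<rparr>"

text \<open>
  The copy of \<open>e\<close> in the \<open>p\<close>-th summand is the pair \<open>(e, p)\<close>.
\<close>

definition homology_matroid ::
    "'a matroid \<Rightarrow> ('a \<Rightarrow> int) \<Rightarrow> ('a \<Rightarrow> int) \<Rightarrow> ('a \<times> int) matroid" where
  "homology_matroid M Z B = direct_sum (graded_piece M Z B)"

definition shift :: "'a \<times> int \<Rightarrow> 'a \<times> int" where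
  "shift x = (fst x, snd x + 1)"

definition orbit :: "'b matroid \<Rightarrow> ('b \<Rightarrow> 'b) \<Rightarrow> 'b \<Rightarrow> 'b set" where
  "orbit N T x = {y. (\<exists>m. y = (T ^^ m) x) \<and> y \<in> ground N \<and> \<not> loop N y}"

definition jordan_basis :: "'b matroid \<Rightarrow> ('b \<Rightarrow> 'b) \<Rightarrow> 'b set \<Rightarrow> bool" where
  "jordan_basis N T A \<longleftrightarrow>
     basis N A \<and>
     (\<exists>X \<subseteq> ground N. A = (\<Union>x \<in> X. orbit N T x) \<and> disjoint_family_on (orbit N T) X)"

end

theory Submission imports Defs begin

text \<open>
  An element \<open>(e, p)\<close> of \<open>N\<close> is a non-loop iff \<open>Z e \<le> p < B e\<close>, so an orbit is an interval
  \<open>{(e, q). p \<le> q < B e}\<close>, and a basis of \<open>H\<^sub>p\<close> is what completes a basis of \<open>B\<^sub>p\<close> to one of \<open>Z\<^sub>p\<close>.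

  Given a Jordan basis with slices \<open>A\<^sub>p\<close> and \<open>p < q\<close>, the elements of \<open>A\<^sub>p\<close> inside \<open>B\<^sub>q\<close> are
  independent over \<open>B\<^sub>p\<close>, whereas those outside \<open>B\<^sub>q\<close> survive to \<open>A\<^sub>q\<close> and are independent over
  \<open>B\<^sub>q\<close>. Adding the resulting lower bounds for the ranks of \<open>Z\<^sub>p \<inter> B\<^sub>q\<close> and \<open>Z\<^sub>p \<union> B\<^sub>q\<close> gives the
  modular law, as submodularity is the opposite inequality.

  Conversely, let \<open>J\<close> be a basis built greedily along the lexicographic order of \<open>(Z e, B e)\<close>. The
  modular law forces \<open>J\<close> to contain a basis of every \<open>Z\<^sub>p\<close> and of every \<open>B\<^sub>q\<close>, and the orbits of the
  \<open>(e, Z e)\<close> with \<open>e \<in> J\<close> form a Jordan basis.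
\<close>

section \<open>Rank in a matroid of finite rank\<close>

lemma basis_inI:
  assumes "J \<subseteq> S" "indep M J" "\<And>K. J \<subseteq> K \<Longrightarrow> K \<subseteq> S \<Longrightarrow> indep M K \<Longrightarrow> K = J"
  shows "basis_in M S J"
  using assms by (simp add: basis_in_def)

lemma basis_in_subset: "basis_in M S J \<Longrightarrow> J \<subseteq> S"
  and basis_in_indep: "basis_in M S J \<Longrightarrow> indep M J"
  and basis_in_eq: "basis_in M S J \<Longrightarrow> J \<subseteq> K \<Longrightarrow> K \<subseteq> S \<Longrightarrow> indep M K \<Longrightarrow> K = J"
  by (simp_all add: basis_in_def)

lemma basis_in_maximal: "basis_in M S J \<Longrightarrow> e \<in> S \<Longrightarrow> indep M (insert e J) \<Longrightarrow> e \<in> J"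
  using basis_in_eq[of M S J "insert e J"] basis_in_subset[of M S J] by auto

locale fin_matroid =
  fixes M :: "'a matroid"
  assumes fin_matroid: "finite_rank_matroid M"
begin

lemmas matroid_axioms = fin_matroid[unfolded finite_rank_matroid_def]

lemmas indep_empty = matroid_axioms[THEN conjunct2, THEN conjunct1]
  and indep_subset = matroid_axioms[THEN conjunct2, THEN conjunct2, THEN conjunct1, rule_format]
  and augment =
    matroid_axioms[THEN conjunct2, THEN conjunct2, THEN conjunct2, THEN conjunct1, rule_format]
  and indep_bounded =
    matroid_axioms[THEN conjunct2, THEN conjunct2, THEN conjunct2, THEN conjunct2]

lemma indep_finite: "indep M I \<Longrightarrow> finite I"
  using indep_bounded by blast

lemma finite_indep_cards: "finite {card I | I. I \<subseteq> S \<and> indep M I}"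
proof -
  obtain k where "\<forall>I. indep M I \<longrightarrow> card I \<le> k" using indep_bounded by blast
  then have "{card I | I. I \<subseteq> S \<and> indep M I} \<subseteq> {..k}" by auto
  then show ?thesis using finite_subset by blast
qed

lemma card_le_rank: "I \<subseteq> S \<Longrightarrow> indep M I \<Longrightarrow> card I \<le> rank M S"
  unfolding rank_def by (rule Max_ge[OF finite_indep_cards]) auto

lemma rank_attained: "\<exists>I. I \<subseteq> S \<and> indep M I \<and> card I = rank M S"
proof -
  have "rank M S \<in> {card I | I. I \<subseteq> S \<and> indep M I}"
    unfolding rank_def by (rule Max_in[OF finite_indep_cards]) (use indep_empty in auto)
  then show ?thesis by auto
qed

lemma basis_in_finite: "basis_in M S J \<Longrightarrow> finite J"
  using indep_finite basis_in_indep by blast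

lemma basis_in_card:
  assumes "basis_in M S J"
  shows "card J = rank M S"
proof (rule ccontr)
  assume ne: "card J \<noteq> rank M S"
  obtain I where I: "I \<subseteq> S" "indep M I" "card I = rank M S" using rank_attained by blast
  have "card J < card I"
    using ne I card_le_rank[OF basis_in_subset[OF assms] basis_in_indep[OF assms]] by simp
  then obtain x where "x \<in> I - J" "indep M (insert x J)"
    using augment[OF basis_in_indep[OF assms] I(2)] by blast
  then show False using basis_in_maximal[OF assms] I by blast
qed

lemma basis_inI_card:
  assumes "J \<subseteq> S" "indep M J" "rank M S \<le> card J"
  shows "basis_in M S J"
proof (rule basis_inI)
  fix K assume K: "J \<subseteq> K" "K \<subseteq> S" "indep M K"
  then have "card K \<le> card J" using card_le_rank[OF K(2,3)] assms(3) by linarith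
  then show "K = J" using K card_seteq[OF indep_finite[OF K(3)]] by blast
qed (use assms in auto)

lemma basis_in_extend:
  assumes "I \<subseteq> S" "indep M I"
  shows "\<exists>J. I \<subseteq> J \<and> basis_in M S J"
proof -
  let ?P = "\<lambda>J. I \<subseteq> J \<and> J \<subseteq> S \<and> indep M J"
  \<comment> \<open>The ground set may be infinite, so a maximal extension comes from the bound on
    cardinalities. That bound has to be strict, whence the \<open>Suc\<close>.\<close>
  have "\<exists>J. ?P J \<and> (\<forall>K. ?P K \<longrightarrow> card K \<le> card J)"
    by (rule ex_has_greatest_nat[where k = I and b = "Suc (rank M S)"])
      (use assms card_le_rank in \<open>auto simp: less_Suc_eq_le\<close>)
  then obtain J where J: "?P J" "\<forall>K. ?P K \<longrightarrow> card K \<le> card J" by blast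
  have "basis_in M S J"
  proof (rule basis_inI)
    fix K assume K: "J \<subseteq> K" "K \<subseteq> S" "indep M K"
    then have "card K \<le> card J" using J by blast
    then show "K = J" using K card_seteq[OF indep_finite[OF K(3)]] by blast
  qed (use J in auto)
  then show ?thesis using J by blast
qed

lemma basis_in_exists: "\<exists>J. basis_in M S J"
  using basis_in_extend[of "{}"] indep_empty by auto

text \<open>Extend a basis \<open>I\<close> of the intersection to a basis \<open>J\<close> of the
  union. The traces of \<open>J\<close> on the two sets are independent and cover \<open>J\<close>,
  and both contain \<open>I\<close>, so their sizes add up to at least
  \<open>card J + card I\<close>.\<close>

lemma rank_submodular: "rank M (S \<union> S') + rank M (S \<inter> S') \<le> rank M S + rank M S'"
proof -
  obtain I where I: "basis_in M (S \<inter> S') I" using basis_in_exists by blast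
  obtain J where J: "I \<subseteq> J" "basis_in M (S \<union> S') J"
    using basis_in_extend[of I "S \<union> S'"] basis_in_subset[OF I] basis_in_indep[OF I] by blast
  have fin: "finite J" and ind: "indep M J" and sub: "J \<subseteq> S \<union> S'"
    using basis_in_finite[OF J(2)] basis_in_indep[OF J(2)] basis_in_subset[OF J(2)] by auto
  have "card I \<le> card (J \<inter> S \<inter> (J \<inter> S'))"
    using fin J(1) basis_in_subset[OF I] by (intro card_mono) auto
  moreover have "(J \<inter> S) \<union> (J \<inter> S') = J" using sub by blast
  ultimately have "card J + card I \<le> card (J \<inter> S) + card (J \<inter> S')"
    using card_Un_Int[of "J \<inter> S" "J \<inter> S'"] fin by simp
  also have "\<dots> \<le> rank M S + rank M S'"
    by (intro add_mono card_le_rank indep_subset[OF ind]) auto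
  finally show ?thesis using basis_in_card[OF I] basis_in_card[OF J(2)] by simp
qed

lemma rank_mono: "S \<subseteq> S' \<Longrightarrow> rank M S \<le> rank M S'"
  using rank_attained[of S] card_le_rank[of _ S'] by (metis subset_trans)

text \<open>The greedy construction: a basis of one member of the chain is extended to a basis of
  the next. Later additions cannot spoil earlier members, since the trace on such a member stays
  independent and already has full rank.\<close>

lemma chain_adapted_indep:
  fixes S :: "nat \<Rightarrow> 'a set"
  assumes "mono S"
  shows "\<exists>J. basis_in M (S t) J \<and> (\<forall>s\<le>t. basis_in M (S s) (J \<inter> S s))"
proof (induction t)
  case 0
  then show ?case
    using basis_in_exists[of "S 0"] basis_in_subset by (metis Int_absorb2 le_zero_eq)
next
  case (Suc t)
  then obtain I where I: "basis_in M (S t) I" "\<forall>s\<le>t. basis_in M (S s) (I \<inter> S s)" by blast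
  have "S t \<subseteq> S (Suc t)" using assms by (simp add: monoD)
  then obtain J where J: "I \<subseteq> J" "basis_in M (S (Suc t)) J"
    using basis_in_extend[of I "S (Suc t)"] basis_in_subset[OF I(1)] basis_in_indep[OF I(1)] by blast
  have "basis_in M (S s) (J \<inter> S s)" if "s \<le> Suc t" for s
  proof (cases "s = Suc t")
    case True
    then show ?thesis using J basis_in_subset by (metis Int_absorb2)
  next
    case False
    then have st: "basis_in M (S s) (I \<inter> S s)" using I that by simp
    have ind: "indep M (J \<inter> S s)" using indep_subset[OF basis_in_indep[OF J(2)]] by blast
    show ?thesis
      using basis_inI_card[of "J \<inter> S s"] ind card_mono[OF indep_finite[OF ind], of "I \<inter> S s"]
        J(1) basis_in_card[OF st] by auto
  qed
  then show ?case using J by blast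
qed

text \<open>Otherwise a basis of \<open>insert e S\<close> extending \<open>J\<close> would avoid
  \<open>e\<close> and hence lie in \<open>S\<close>, so adding \<open>e\<close> would not raise the
  rank.\<close>

lemma insert_basis_in_indep:
  assumes "basis_in M S J" "rank M (insert e S) \<noteq> rank M S"
  shows "indep M (insert e J)"
proof (rule ccontr)
  assume dep: "\<not> indep M (insert e J)"
  obtain K where K: "J \<subseteq> K" "basis_in M (insert e S) K"
    using basis_in_extend[of J "insert e S"] basis_in_subset[OF assms(1)]
      basis_in_indep[OF assms(1)] by blast
  have "e \<notin> K" using dep indep_subset[OF basis_in_indep[OF K(2)]] K(1) by blast
  then have "K \<subseteq> S" using basis_in_subset[OF K(2)] by blast
  then have "rank M (insert e S) \<le> rank M S"
    using card_le_rank[of K S] basis_in_indep[OF K(2)] basis_in_card[OF K(2)] by simp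
  then show False using assms(2) rank_mono[of S "insert e S"] by fastforce
qed

text \<open>
  In lattice terms: if \<open>(a, b)\<close> is a modular pair, so is \<open>(a, c \<inter> b)\<close> for every \<open>c \<ge> a\<close>.
\<close>

lemma modular_pair_restrict:
  assumes "rank M (a \<union> b) + rank M (a \<inter> b) = rank M a + rank M b" "a \<subseteq> c"
  shows "rank M a + rank M (c \<inter> b) \<le> rank M (a \<union> (c \<inter> b)) + rank M (a \<inter> b)"
proof -
  have "(a \<union> (c \<inter> b)) \<union> b = a \<union> b" "(a \<union> (c \<inter> b)) \<inter> b = c \<inter> b" using assms(2) by auto
  then show ?thesis using rank_submodular[of "a \<union> (c \<inter> b)" b] assms(1) by simp
qed

end

section \<open>Bases of direct sums and of the graded pieces\<close>

lemma ground_direct_sum: "ground (direct_sum H) = {(e, i). e \<in> ground (H i)}"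
  and indep_direct_sum: "indep (direct_sum H) A \<longleftrightarrow>
    A \<subseteq> {(e, i). e \<in> ground (H i)} \<and> (\<forall>i. indep (H i) {e. (e, i) \<in> A})"
  by (simp_all add: direct_sum_def)

lemma basis_direct_sum: "basis (direct_sum H) A \<longleftrightarrow> (\<forall>i. basis (H i) {e. (e, i) \<in> A})"
  unfolding basis_def
proof (intro iffI allI)
  fix i
  assume A: "basis_in (direct_sum H) (ground (direct_sum H)) A"
  have ind: "indep (direct_sum H) A" using basis_in_indep[OF A] .
  show "basis_in (H i) (ground (H i)) {e. (e, i) \<in> A}"
  proof (rule basis_inI)
    fix K assume K: "{e. (e, i) \<in> A} \<subseteq> K" "K \<subseteq> ground (H i)" "indep (H i) K"
    \<comment> \<open>Enlarge only the \<open>i\<close>-th slice, to \<open>K\<close>; maximality of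
      \<open>A\<close> then applies to the whole sum.\<close>
    let ?C = "A \<union> K \<times> {i}"
    have "{e. (e, j) \<in> ?C} = (if j = i then K else {e. (e, j) \<in> A})" for j using K(1) by auto
    then have "indep (direct_sum H) ?C" "?C \<subseteq> ground (direct_sum H)"
      using ind K unfolding indep_direct_sum ground_direct_sum by auto
    then have "?C = A" by (intro basis_in_eq[OF A]) auto
    then show "K = {e. (e, i) \<in> A}" using K(1) by auto
  qed (use ind in \<open>auto simp: indep_direct_sum\<close>)
next
  assume A: "\<forall>i. basis_in (H i) (ground (H i)) {e. (e, i) \<in> A}"
  note sub = basis_in_subset[OF spec[OF A]] and ind = basis_in_indep[OF spec[OF A]]
  show "basis_in (direct_sum H) (ground (direct_sum H)) A"
  proof (rule basis_inI)
    fix K assume K: "A \<subseteq> K" "indep (direct_sum H) K"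
    have "{e. (e, i) \<in> K} = {e. (e, i) \<in> A}" for i
      by (rule basis_in_eq[OF spec[OF A]]) (use K in \<open>auto simp: indep_direct_sum\<close>)
    then show "K = A" by (auto simp: set_eq_iff)
  qed (use sub ind in \<open>auto simp: indep_direct_sum ground_direct_sum\<close>)
qed

lemma ground_graded_piece: "ground (graded_piece M Z B p) = level M Z p"
  and indep_graded_piece: "indep (graded_piece M Z B p) I \<longleftrightarrow> I \<subseteq> level M Z p \<and>
    (\<exists>J. basis_in M (level M B p) J \<and> indep M (I \<union> J) \<and> I \<inter> J = {})"
  by (simp_all add: graded_piece_def)

context fin_matroid
begin

lemma basis_graded_piece:
  assumes "level M B p \<subseteq> level M Z p"
  shows "basis (graded_piece M Z B p) I \<longleftrightarrow>
    (\<exists>J. basis_in M (level M B p) J \<and> I \<inter> J = {} \<and> basis_in M (level M Z p) (I \<union> J))"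
proof
  assume I: "basis (graded_piece M Z B p) I"
  then have "indep (graded_piece M Z B p) I" unfolding basis_def by (rule basis_in_indep)
  then obtain J where J: "basis_in M (level M B p) J" "indep M (I \<union> J)" "I \<inter> J = {}"
    and IZ: "I \<subseteq> level M Z p"
    unfolding indep_graded_piece by blast
  have "basis_in M (level M Z p) (I \<union> J)"
  proof (rule basis_inI)
    fix K assume K: "I \<union> J \<subseteq> K" "K \<subseteq> level M Z p" "indep M K"
    \<comment> \<open>The part of \<open>K\<close> outside \<open>J\<close> is independent in the
      graded piece, with the same witness \<open>J\<close> as for \<open>I\<close>.\<close>
    have "(K - J) \<union> J = K" using K by blast
    then have "indep (graded_piece M Z B p) (K - J)"
      using K J(1) unfolding indep_graded_piece by auto
    moreover have "K - J \<subseteq> ground (graded_piece M Z B p)" "I \<subseteq> K - J"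
      using K J(3) unfolding ground_graded_piece by auto
    ultimately have "K - J = I" using basis_in_eq I unfolding basis_def by blast
    then show "K = I \<union> J" using K by blast
  qed (use J IZ basis_in_subset[OF J(1)] assms in auto)
  then show "\<exists>J. basis_in M (level M B p) J \<and> I \<inter> J = {} \<and> basis_in M (level M Z p) (I \<union> J)"
    using J by blast
next
  assume "\<exists>J. basis_in M (level M B p) J \<and> I \<inter> J = {} \<and> basis_in M (level M Z p) (I \<union> J)"
  then obtain J where J: "basis_in M (level M B p) J" "I \<inter> J = {}"
    "basis_in M (level M Z p) (I \<union> J)" by blast
  have fin: "finite I" "finite J" using basis_in_finite[OF J(3)] by auto
  show "basis (graded_piece M Z B p) I" unfolding basis_def ground_graded_piece
  proof (rule basis_inI)
    show "indep (graded_piece M Z B p) I"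
      using J basis_in_subset[OF J(3)] basis_in_indep[OF J(3)] unfolding indep_graded_piece by auto
    fix K assume K: "I \<subseteq> K" "K \<subseteq> level M Z p" "indep (graded_piece M Z B p) K"
    \<comment> \<open>The witness for \<open>K\<close> may differ from \<open>J\<close>. Only
      cardinalities are compared, and any two bases of \<open>level M B p\<close> have the same
      size.\<close>
    obtain J' where J': "basis_in M (level M B p) J'" "indep M (K \<union> J')" "K \<inter> J' = {}"
      using K(3) unfolding indep_graded_piece by blast
    have finK: "finite K" "finite J'" using indep_finite[OF J'(2)] by auto
    have "card (K \<union> J') \<le> rank M (level M Z p)"
      using card_le_rank[OF _ J'(2)] K(2) basis_in_subset[OF J'(1)] assms by blast
    then have "card (K \<union> J') \<le> card (I \<union> J)" using basis_in_card[OF J(3)] by simp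
    then have "card K \<le> card I"
      using card_Un_disjoint[OF finK J'(3)] card_Un_disjoint[OF fin J(2)]
        basis_in_card[OF J(1)] basis_in_card[OF J'(1)] by simp
    then show "K = I" using card_seteq[OF finK(1) K(1)] by blast
  qed (use basis_in_subset[OF J(3)] in auto)
qed

end

section \<open>Orbits and the modular law\<close>

lemma funpow_shift: "(shift ^^ m) (e, p) = (e, p + int m)"
  by (induction m) (auto simp: shift_def)

lemma level_mono: "p \<le> q \<Longrightarrow> level M F p \<subseteq> level M F q"
  unfolding level_def by auto

locale two_filtrations = fin_matroid M for M :: "'a matroid" +
  fixes Z B :: "'a \<Rightarrow> int"
  assumes Z_filtration: "closed_filtration M Z"
    and B_filtration: "closed_filtration M B"
    and B_subset_Z: "\<And>p. level M B p \<subseteq> level M Z p"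
begin

lemma filtration_ge_1: "closed_filtration M F \<Longrightarrow> e \<in> ground M \<Longrightarrow> 1 \<le> F e"
  unfolding closed_filtration_def by auto

lemma flat_level:
  assumes "closed_filtration M F" "1 \<le> p"
  shows "flat M (level M F p)"
proof -
  obtain n where n: "\<forall>e \<in> ground M. F e \<in> {1..n}" "\<forall>p \<in> {1..n}. flat M (level M F p)"
    using assms(1) unfolding closed_filtration_def by blast
  show ?thesis
  proof (cases "p \<le> n")
    case False
    then have "level M F p = ground M" using n(1) unfolding level_def by fastforce
    then show ?thesis unfolding flat_def closure_in_def by (auto simp: insert_absorb)
  qed (use assms n in auto)
qed

lemma indep_graded_piece_empty: "indep (graded_piece M Z B p) {}"
  using basis_in_exists basis_in_indep unfolding indep_graded_piece by fastforce

text \<open>This is where closedness of the levels of \<open>B\<close> enters: an element outside a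
  flat is outside its closure, so it extends any basis of the flat.\<close>

lemma indep_graded_piece_singleton:
  assumes "e \<in> level M Z p"
  shows "indep (graded_piece M Z B p) {e} \<longleftrightarrow> p < B e"
proof
  assume "indep (graded_piece M Z B p) {e}"
  then obtain J where J: "basis_in M (level M B p) J" "indep M (insert e J)" "e \<notin> J"
    unfolding indep_graded_piece by auto
  then have "e \<notin> level M B p" using basis_in_maximal[OF J(1)] by blast
  then show "p < B e" using assms unfolding level_def by auto
next
  assume less: "p < B e"
  \<comment> \<open>The bound \<open>1 \<le> p\<close> follows from
    \<open>1 \<le> Z e \<le> p\<close>. It matters because flatness is only available for positive
    levels.\<close>
  have e: "e \<in> ground M" "1 \<le> p" "e \<notin> level M B p"
    using assms less filtration_ge_1[OF Z_filtration, of e] unfolding level_def by auto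
  obtain J where J: "basis_in M (level M B p) J" using basis_in_exists by blast
  have "e \<notin> closure_in M (level M B p)"
    using flat_level[OF B_filtration e(2)] e(3) unfolding flat_def by simp
  then have "indep M (insert e J)"
    using insert_basis_in_indep[OF J] e(1) unfolding closure_in_def by blast
  then show "indep (graded_piece M Z B p) {e}"
    using J e(3) basis_in_subset[OF J] assms unfolding indep_graded_piece by auto
qed

abbreviation N :: "('a \<times> int) matroid" where "N \<equiv> homology_matroid M Z B"

lemma ground_N: "(e, p) \<in> ground N \<longleftrightarrow> e \<in> level M Z p"
  unfolding homology_matroid_def direct_sum_def by (auto simp: ground_graded_piece)

lemma loop_N:
  assumes "e \<in> level M Z p"
  shows "loop N (e, p) \<longleftrightarrow> B e \<le> p"
proof -
  have "{e'. (e', i) \<in> {(e, p)}} = (if i = p then {e} else {})" for i by auto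
  then have "indep N {(e, p)} \<longleftrightarrow> indep (graded_piece M Z B p) {e}"
    using assms indep_graded_piece_empty
    unfolding homology_matroid_def direct_sum_def by (auto simp: ground_graded_piece)
  then show ?thesis
    using indep_graded_piece_singleton[OF assms] assms ground_N unfolding loop_def by auto
qed

lemma orbit_N: "orbit N shift (e, p) = {(e, q) | q. p \<le> q \<and> e \<in> level M Z q \<and> q < B e}"
proof -
  have "(\<exists>m. (e', q) = (shift ^^ m) (e, p)) \<longleftrightarrow> e' = e \<and> p \<le> q" for e' q
    by (auto simp: funpow_shift intro: exI[of _ "nat (q - p)"])
  then have "(e', q) \<in> orbit N shift (e, p) \<longleftrightarrow>
      e' = e \<and> p \<le> q \<and> e \<in> level M Z q \<and> q < B e" for e' q
    using loop_N[of e q] ground_N unfolding orbit_def by auto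
  then show ?thesis by auto
qed

lemma basis_N: "basis N A \<longleftrightarrow>
    (\<forall>p. \<exists>J. basis_in M (level M B p) J \<and> {e. (e, p) \<in> A} \<inter> J = {} \<and>
       basis_in M (level M Z p) ({e. (e, p) \<in> A} \<union> J))"
  unfolding homology_matroid_def basis_direct_sum basis_graded_piece[OF B_subset_Z] ..

text \<open>Comparable sets always satisfy the modular law. Each filtration is a chain, and
  \<open>level M B q\<close> lies in \<open>level M Z p\<close> for \<open>q \<le> p\<close>, so
  only the pairs with \<open>p < q\<close> remain. For these, submodularity supplies the other
  inequality.\<close>

lemma modular_law_filtrations:
  "modular_law M (range (level M Z) \<union> range (level M B)) \<longleftrightarrow>
   (\<forall>p q. p < q \<longrightarrow> rank M (level M Z p) + rank M (level M B q) \<le>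
      rank M (level M Z p \<union> level M B q) + rank M (level M Z p \<inter> level M B q))"
  (is "?L \<longleftrightarrow> ?R")
proof
  assume L: ?L
  have "rank M (level M Z p \<union> level M B q) + rank M (level M Z p \<inter> level M B q) =
      rank M (level M Z p) + rank M (level M B q)" for p q
    using L unfolding modular_law_def by blast
  then show ?R by simp
next
  assume R: ?R
  define P where "P S S' \<longleftrightarrow> rank M (S \<union> S') + rank M (S \<inter> S') = rank M S + rank M S'" for S S'
  have comparable: "P S S'" if "S \<subseteq> S' \<or> S' \<subseteq> S" for S S'
    using that unfolding P_def by (auto simp: Un_absorb1 Un_absorb2 Int_absorb1 Int_absorb2)
  have commute: "P S S' \<Longrightarrow> P S' S" for S S'
    unfolding P_def by (simp add: Un_commute Int_commute add.commute)
  have chain: "P (level M F p) (level M F q)" for F p q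
    by (rule comparable) (cases "p \<le> q"; simp add: level_mono)
  have ZB: "P (level M Z p) (level M B q)" for p q
  proof (cases "p < q")
    case True
    then show ?thesis
      using R rank_submodular[of "level M Z p" "level M B q"] unfolding P_def
      by (simp add: order_antisym)
  next
    case False
    then have "level M B q \<subseteq> level M Z p"
      using level_mono[of q p M B] B_subset_Z[of p] by simp
    then show ?thesis by (intro comparable disjI2)
  qed
  have "P S S'" if "S \<in> range (level M Z) \<union> range (level M B)"
    "S' \<in> range (level M Z) \<union> range (level M B)" for S S'
    using that by (auto intro: chain ZB commute[OF ZB])
  then show ?L unfolding modular_law_def P_def by blast
qed

section \<open>From a Jordan basis to the modular law\<close>

lemma jordan_basis_imp_modular_law:
  assumes "jordan_basis N shift A"
  shows "modular_law M (range (level M Z) \<union> range (level M B))"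
  unfolding modular_law_filtrations
proof (intro allI impI)
  fix p q :: int assume pq: "p < q"
  obtain X where bas: "basis N A" and X: "A = (\<Union>x \<in> X. orbit N shift x)"
    using assms unfolding jordan_basis_def by blast
  let ?A = "\<lambda>p. {e. (e, p) \<in> A}"
  obtain J where J: "basis_in M (level M B p) J" "?A p \<inter> J = {}"
    "basis_in M (level M Z p) (?A p \<union> J)" using bas unfolding basis_N by blast
  obtain J' where J': "basis_in M (level M B q) J'" "?A q \<inter> J' = {}"
    "basis_in M (level M Z q) (?A q \<union> J')" using bas unfolding basis_N by blast
  have fin: "finite (?A p)" "finite J" "finite J'"
    using basis_in_finite[OF J(3)] basis_in_finite[OF J'(1)] by auto
  have AZ: "?A p \<subseteq> level M Z p" using basis_in_subset[OF J(3)] by blast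
  \<comment> \<open>The orbit through \<open>(e, p)\<close> starts at some \<open>r \<le> p\<close>
    and stops only at \<open>B e\<close>, which exceeds \<open>q\<close>.\<close>
  have survive: "e \<in> ?A q" if e: "e \<in> ?A p" "e \<notin> level M B q" for e
  proof -
    have "e \<in> level M Z p" using AZ e(1) by blast
    then have "e \<in> level M Z q" "q < B e"
      using e(2) pq unfolding level_def by auto
    moreover obtain r where "(e, r) \<in> X" "r \<le> p" using e(1) unfolding X by (auto simp: orbit_N)
    ultimately show ?thesis using pq unfolding X by (force simp: orbit_N)
  qed
  have "card (?A p \<inter> level M B q) + card J = card ((?A p \<inter> level M B q) \<union> J)"
    using J(2) fin by (subst card_Un_disjoint) auto
  also have "\<dots> \<le> rank M (level M Z p \<inter> level M B q)"
  proof (rule card_le_rank)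
    show "(?A p \<inter> level M B q) \<union> J \<subseteq> level M Z p \<inter> level M B q"
      using AZ basis_in_subset[OF J(1)] B_subset_Z[of p] level_mono[of p q M B] pq by auto
    show "indep M ((?A p \<inter> level M B q) \<union> J)"
      by (rule indep_subset[OF basis_in_indep[OF J(3)]]) auto
  qed
  finally have 1: "card (?A p \<inter> level M B q) + card J \<le> rank M (level M Z p \<inter> level M B q)" .
  \<comment> \<open>Survivors lie in \<open>?A q\<close>, which is disjoint from
    \<open>J'\<close>.\<close>
  have "card (?A p - level M B q) + card J' = card ((?A p - level M B q) \<union> J')"
    using J'(2) survive fin by (subst card_Un_disjoint) auto
  also have "\<dots> \<le> rank M (level M Z p \<union> level M B q)"
  proof (rule card_le_rank)
    show "(?A p - level M B q) \<union> J' \<subseteq> level M Z p \<union> level M B q"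
      using AZ basis_in_subset[OF J'(1)] by blast
    show "indep M ((?A p - level M B q) \<union> J')"
      by (rule indep_subset[OF basis_in_indep[OF J'(3)]]) (use survive in auto)
  qed
  finally have 2: "card (?A p - level M B q) + card J' \<le> rank M (level M Z p \<union> level M B q)" .
  have "card (?A p) = card (?A p \<inter> level M B q) + card (?A p - level M B q)"
    by (rule card_Int_Diff[OF fin(1)])
  moreover have "card (?A p) + card J = rank M (level M Z p)"
    using basis_in_card[OF J(3)] card_Un_disjoint[OF fin(1,2) J(2)] by simp
  ultimately show "rank M (level M Z p) + rank M (level M B q) \<le>
      rank M (level M Z p \<union> level M B q) + rank M (level M Z p \<inter> level M B q)"
    using 1 2 basis_in_card[OF J'(1)] by linarith
qed

section \<open>From the modular law to a Jordan basis\<close>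

lemma bounded_filtrations:
  obtains n where "1 \<le> n" "\<And>e. e \<in> ground M \<Longrightarrow> Z e \<in> {1..n} \<and> B e \<in> {1..n}"
proof -
  obtain a b where "\<forall>e \<in> ground M. Z e \<in> {1..a}" "\<forall>e \<in> ground M. B e \<in> {1..b}"
    using Z_filtration B_filtration unfolding closed_filtration_def by blast
  \<comment> \<open>The \<open>1\<close> covers an empty ground set, for which \<open>a\<close> and
    \<open>b\<close> may be nonpositive.\<close>
  then show ?thesis using that[of "max 1 (max a b)"] by fastforce
qed

text \<open>The sets in the last clause are the initial segments of the lexicographic order of
  \<open>(Z e, B e)\<close>. They form a chain, so a single greedy independent set is adapted to all
  of them.\<close>

lemma lexicographic_basis:
  obtains J where "indep M J"
    "\<And>p. basis_in M (level M Z p) (J \<inter> level M Z p)"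
    "\<And>p q. basis_in M (level M Z (p - 1) \<union> (level M Z p \<inter> level M B q))
       (J \<inter> (level M Z (p - 1) \<union> (level M Z p \<inter> level M B q)))"
proof -
  obtain n where n: "1 \<le> n" "\<And>e. e \<in> ground M \<Longrightarrow> Z e \<in> {1..n} \<and> B e \<in> {1..n}"
    using bounded_filtrations by blast
  \<comment> \<open>Two digits in base \<open>n + 1\<close>: as \<open>B e\<close> lies in
    \<open>{1..n}\<close>, no carry occurs and \<open>f\<close> encodes the lexicographic order as
    one integer.\<close>
  define f where "f e = Z e * (n + 1) + B e" for e
  define S where "S t = {e \<in> ground M. f e \<le> int t}" for t
  have "mono S" unfolding S_def mono_def by auto
  have key: "f e \<le> p * (n + 1) + q \<longleftrightarrow> Z e \<le> p - 1 \<or> Z e \<le> p \<and> B e \<le> q"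
    if "e \<in> ground M" "0 \<le> q" "q \<le> n" for e p q
  proof -
    consider "Z e \<le> p - 1" | "Z e = p" | "p + 1 \<le> Z e" by linarith
    then show ?thesis
    proof cases
      case 1
      then have "Z e * (n + 1) \<le> (p - 1) * (n + 1)" using n(1) by (intro mult_right_mono) auto
      then have "f e \<le> p * (n + 1) + q"
        using n(2)[OF that(1)] that(2) by (auto simp: f_def algebra_simps)
      then show ?thesis using 1 by simp
    next
      case 3
      then have "(p + 1) * (n + 1) \<le> Z e * (n + 1)" using n(1) by (intro mult_right_mono) auto
      then have "\<not> f e \<le> p * (n + 1) + q"
        using n(2)[OF that(1)] that(3) by (auto simp: f_def algebra_simps)
      then show ?thesis using 3 by simp
    qed (auto simp: f_def)
  qed
  define L where "L p q = level M Z (p - 1) \<union> (level M Z p \<inter> level M B q)" for p q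
  \<comment> \<open>The largest value that \<open>f\<close> can take, so that \<open>S t\<close> is
    the whole ground set.\<close>
  define t where "t = nat (n * (n + 1) + n)"
  obtain J where J: "basis_in M (S t) J" "\<forall>s\<le>t. basis_in M (S s) (J \<inter> S s)"
    using chain_adapted_indep[OF \<open>mono S\<close>] by blast
  have lex: "basis_in M (L p q) (J \<inter> L p q)" for p q
  proof -
    \<comment> \<open>Clamping \<open>q\<close> to the range of a digit leaves
      \<open>B e \<le> q\<close> unchanged for elements of the ground set.\<close>
    define q' where "q' = max 0 (min q n)"
    have q': "0 \<le> q'" "q' \<le> n" using n(1) unfolding q'_def by auto
    have eq: "e \<in> L p q \<longleftrightarrow> f e \<le> p * (n + 1) + q'" if "e \<in> ground M" for e
    proof -
      have "B e \<le> q' \<longleftrightarrow> B e \<le> q"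
        using n(2)[OF that] unfolding q'_def by (auto simp: le_max_iff_disj)
      then show ?thesis using key[OF that q'] that unfolding L_def level_def by simp
    qed
    show ?thesis
    proof (cases "1 \<le> p \<and> p \<le> n")
      case True
      have "0 \<le> p * (n + 1)" using True n(1) by simp
      then have "L p q = S (nat (p * (n + 1) + q'))"
        using eq q' unfolding S_def by (auto simp: L_def level_def)
      moreover have "p * (n + 1) \<le> n * (n + 1)" using True n(1) by (intro mult_right_mono) auto
      then have "nat (p * (n + 1) + q') \<le> t"
        unfolding t_def using q' by (intro nat_mono add_mono)
      ultimately show ?thesis using J(2) by simp
    next
      case False
      then consider "p \<le> 0" | "n < p" by linarith
      then show ?thesis
      proof cases
        case 1
        then have "L p q = {}" using n(2) unfolding L_def level_def by fastforce
        then show ?thesis using indep_empty by (auto simp: basis_in_def)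
      next
        case 2
        then have "L p q = ground M" using n(2) unfolding L_def level_def by fastforce
        moreover have "S t = ground M"
          using key[of _ n n] n by (fastforce simp: S_def t_def)
        ultimately show ?thesis using J(2) by (metis order_refl)
      qed
    qed
  qed
  \<comment> \<open>No element has \<open>B e \<le> 0\<close>, so at second digit 0 only the earlier
    \<open>Z\<close>-level is left.\<close>
  have "level M Z p = L (p + 1) 0" for p
    using n(2) unfolding L_def level_def by fastforce
  then have "basis_in M (level M Z p) (J \<inter> level M Z p)" for p using lex by metis
  then show ?thesis using that basis_in_indep[OF J(1)] lex unfolding L_def by blast
qed

text \<open>The lexicographic set already meets each \<open>Z\<close>-level in a basis. Induction
  along the \<open>Z\<close>-levels shows that it also has full rank on each intersection with a
  \<open>B\<close>-level; at the top these intersections are the \<open>B\<close>-levels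
  themselves.\<close>

lemma common_basis:
  assumes "modular_law M (range (level M Z) \<union> range (level M B))"
  obtains J where "\<And>p. basis_in M (level M Z p) (J \<inter> level M Z p)"
    "\<And>q. basis_in M (level M B q) (J \<inter> level M B q)"
proof -
  obtain J where J: "indep M J" "\<And>p. basis_in M (level M Z p) (J \<inter> level M Z p)"
    "\<And>p q. basis_in M (level M Z (p - 1) \<union> (level M Z p \<inter> level M B q))
       (J \<inter> (level M Z (p - 1) \<union> (level M Z p \<inter> level M B q)))"
    using lexicographic_basis by blast
  obtain n where n: "1 \<le> n" "\<And>e. e \<in> ground M \<Longrightarrow> Z e \<in> {1..n} \<and> B e \<in> {1..n}"
    using bounded_filtrations by blast
  note fin = indep_finite[OF J(1)]
  have cell: "rank M (level M Z (int k) \<inter> level M B q)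
      \<le> card (J \<inter> (level M Z (int k) \<inter> level M B q))" for k q
  proof (induction k)
    case 0
    have "level M Z (int 0) = {}" using n(2) unfolding level_def by fastforce
    then show ?case using rank_attained[of "{}"] by auto
  next
    case (Suc k)
    let ?a = "level M Z (int k)" and ?c = "level M Z (int (Suc k))" and ?b = "level M B q"
    have ac: "?a \<subseteq> ?c" by (rule level_mono) simp
    \<comment> \<open>Modularity of \<open>?a\<close> and \<open>?b\<close> passes to
      \<open>?a\<close> and \<open>?c \<inter> ?b\<close>. Since \<open>J\<close> attains the ranks
      of \<open>?a\<close> and \<open>?a \<union> (?c \<inter> ?b)\<close>, counting
      \<open>J\<close> on both sides carries the bound from \<open>?a \<inter> ?b\<close> to
      \<open>?c \<inter> ?b\<close>.\<close>
    have "rank M (?a \<union> ?b) + rank M (?a \<inter> ?b) = rank M ?a + rank M ?b"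
      using assms unfolding modular_law_def by blast
    note modular_pair_restrict[OF this ac]
    moreover have "card (J \<inter> ?a) = rank M ?a" using basis_in_card[OF J(2)] .
    moreover have "card (J \<inter> (?a \<union> (?c \<inter> ?b))) = rank M (?a \<union> (?c \<inter> ?b))"
      using basis_in_card[OF J(3)[of "int (Suc k)" q]] by simp
    moreover have "card (J \<inter> ?a) + card (J \<inter> (?c \<inter> ?b)) =
        card (J \<inter> (?a \<union> (?c \<inter> ?b))) + card (J \<inter> (?a \<inter> ?b))"
    proof -
      have "(J \<inter> ?a) \<union> (J \<inter> (?c \<inter> ?b)) = J \<inter> (?a \<union> (?c \<inter> ?b))"
        "(J \<inter> ?a) \<inter> (J \<inter> (?c \<inter> ?b)) = J \<inter> (?a \<inter> ?b)"
        using ac by auto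
      then show ?thesis using card_Un_Int[of "J \<inter> ?a" "J \<inter> (?c \<inter> ?b)"] fin by simp
    qed
    ultimately show ?case using Suc by linarith
  qed
  have "basis_in M (level M B q) (J \<inter> level M B q)" for q
  proof (rule basis_inI_card)
    have "level M Z (int (nat n)) \<inter> level M B q = level M B q"
      using n unfolding level_def by auto
    then show "rank M (level M B q) \<le> card (J \<inter> level M B q)" using cell[of "nat n" q] by simp
  qed (use indep_subset[OF J(1)] in auto)
  then show ?thesis using that J(2) by blast
qed

lemma modular_law_imp_jordan_basis:
  assumes "modular_law M (range (level M Z) \<union> range (level M B))"
  shows "\<exists>A. jordan_basis N shift A"
proof -
  obtain J where JZ: "\<And>p. basis_in M (level M Z p) (J \<inter> level M Z p)"
    and JB: "\<And>q. basis_in M (level M B q) (J \<inter> level M B q)"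
    using common_basis[OF assms] by blast
  \<comment> \<open>Each orbit starts at \<open>Z e\<close>, the first level containing
    \<open>e\<close>. Intersecting with the ground set ensures that these starting points belong to
    \<open>N\<close>.\<close>
  define X where "X = (\<lambda>e. (e, Z e)) ` (J \<inter> ground M)"
  define A where "A = (\<Union>x \<in> X. orbit N shift x)"
  have slice: "{e. (e, p) \<in> A} = J \<inter> level M Z p - level M B p" for p
    unfolding A_def X_def by (auto simp: orbit_N level_def)
  have "basis N A" unfolding basis_N slice
  proof
    fix p
    have "(J \<inter> level M Z p - level M B p) \<union> (J \<inter> level M B p) = J \<inter> level M Z p"
      using B_subset_Z[of p] by blast
    then have "basis_in M (level M Z p) ((J \<inter> level M Z p - level M B p) \<union> (J \<inter> level M B p))"
      using JZ by simp
    then show "\<exists>I. basis_in M (level M B p) I \<and> (J \<inter> level M Z p - level M B p) \<inter> I = {} \<and>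
        basis_in M (level M Z p) (J \<inter> level M Z p - level M B p \<union> I)"
      using JB by blast
  qed
  moreover have "X \<subseteq> ground N" unfolding X_def by (auto simp: ground_N level_def)
  \<comment> \<open>Distinct orbits have distinct first components.\<close>
  moreover have "disjoint_family_on (orbit N shift) X"
    unfolding disjoint_family_on_def X_def by (auto simp: orbit_N)
  ultimately show ?thesis unfolding jordan_basis_def A_def by blast
qed

end

theorem proposition5p2p4:
  fixes M :: "'a matroid" and Z B :: "'a \<Rightarrow> int"
  assumes "finite_rank_matroid M"
    and "closed_filtration M Z" and "closed_filtration M B"
    and "\<forall>p. level M B p \<subseteq> level M Z p"
  shows "(\<exists>A. jordan_basis (homology_matroid M Z B) shift A) \<longleftrightarrow>
         modular_law M (range (level M Z) \<union> range (level M B))"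
proof -
  interpret two_filtrations M Z B
    by unfold_locales (use assms in auto)
  show ?thesis using jordan_basis_imp_modular_law modular_law_imp_jordan_basis by blast
qed

end
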